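(* There is an absolute constant $c>0$ such that the following holds. Fix an integer $k\geq 1$, a constant $z\geq 1$, and an error parameter $\varepsilon\in(0,1)$ with $\varepsilon \geq c\, k^{-1/(z+2)}$. Then there exists a finite instance $P\subset \mathbb{R}^d$ (for some dimension $d \geq \Omega(k\varepsilon^{-z})$) such that every $\varepsilon$-coreset of $P$ for $(k,z)$-Clustering in $\mathbb{R}^d$ has size at least $\Omega(k\varepsilon^{-z-2})$.
   Context: For a metric space $(\mathcal{X},d)$, a finite dataset $P\subseteq\mathcal{X}$, $z\geq1$ and a set $C\subseteq\mathcal{X}$ of $k$ points (a center set), define $\mathrm{cost}_z(P,C)=\sum_{x\in P} d(x,C)^z$ where $d(x,C)=\min_{c\in C}d(x,c)$. An $\varepsilon$-coreset of $P$ for $(k,z)$-Clustering is a subset $S\subseteq P$ with weights $w:S\to\mathbb{R}_{\geq 0}$ such that for every $C\in\mathcal{X}^k$, $\sum_{x\in S} w(x)\, d(x,C)^z \in (1\pm\varepsilon)\,\mathrm{cost}_z(P,C)$. Its size is $|S|$. Here $\mathcal{X}=\mathbb{R}^d$ with the Euclidean distance. Asymptotic notation hides constants that may depend on $z$. *)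

theory Defs
  imports "HOL-Analysis.Analysis"
begin

text \<open>The dimension is quantified inside the statement, so \<open>\<real>\<^sup>n\<close> is the set
  \<open>topspace (Euclidean_space n)\<close> of sequences vanishing from index \<open>n\<close> on, with the metric below.\<close>

definition euclid_dist :: "nat \<Rightarrow> (nat \<Rightarrow> real) \<Rightarrow> (nat \<Rightarrow> real) \<Rightarrow> real" where
  "euclid_dist n x y = L2_set (\<lambda>i. x i - y i) {..<n}"

lemma Metric_space_euclid_dist:
  "Metric_space (topspace (Euclidean_space n)) (euclid_dist n)"
proof
  fix x y :: "nat \<Rightarrow> real"
  show "0 \<le> euclid_dist n x y"
    by (simp add: euclid_dist_def)
  show "euclid_dist n x y = euclid_dist n y x"
    by (simp add: euclid_dist_def L2_set_def power2_commute)
next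
  fix x y :: "nat \<Rightarrow> real"
  assume "x \<in> topspace (Euclidean_space n)" "y \<in> topspace (Euclidean_space n)"
  then have "x i = y i" if "i \<ge> n" for i
    using that by (simp add: topspace_Euclidean_space)
  then show "euclid_dist n x y = 0 \<longleftrightarrow> x = y"
    by (auto simp: euclid_dist_def L2_set_eq_0_iff fun_eq_iff) (metis lessThan_iff not_less)
next
  fix x y z :: "nat \<Rightarrow> real"
  show "euclid_dist n x z \<le> euclid_dist n x y + euclid_dist n y z"
    using L2_set_triangle_ineq[of "\<lambda>i. x i - y i" "\<lambda>i. y i - z i" "{..<n}"]
    by (simp add: euclid_dist_def)
qed

text \<open>In what follows \<open>X\<close> is the carrier and \<open>d\<close> the distance of a metric space.
  Center sets come from \<open>k\<close>-tuples in \<open>X\<close>, so repeated centers are allowed.\<close>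

definition center_sets :: "'a set \<Rightarrow> nat \<Rightarrow> 'a set set" where
  "center_sets X k = {set cs | cs. length cs = k \<and> set cs \<subseteq> X}"

definition dist_to_set :: "('a \<Rightarrow> 'a \<Rightarrow> real) \<Rightarrow> 'a \<Rightarrow> 'a set \<Rightarrow> real" where
  "dist_to_set d x C = Min ((\<lambda>c. d x c) ` C)"

definition clustering_cost ::
    "('a \<Rightarrow> 'a \<Rightarrow> real) \<Rightarrow> real \<Rightarrow> 'a set \<Rightarrow> 'a set \<Rightarrow> real" where
  "clustering_cost d z P C = (\<Sum>x\<in>P. dist_to_set d x C powr z)"

definition is_coreset ::
    "'a set \<Rightarrow> ('a \<Rightarrow> 'a \<Rightarrow> real) \<Rightarrow> nat \<Rightarrow> real \<Rightarrow> real \<Rightarrow> 'a set \<Rightarrow> 'a set \<Rightarrow> ('a \<Rightarrow> real) \<Rightarrow> bool" where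
  "is_coreset X d k z \<epsilon> P S w \<longleftrightarrow>
     S \<subseteq> P \<and> (\<forall>x\<in>S. 0 \<le> w x) \<and>
     (\<forall>C\<in>center_sets X k.
        (\<Sum>x\<in>S. w x * dist_to_set d x C powr z)
          \<in> {(1 - \<epsilon>) * clustering_cost d z P C .. (1 + \<epsilon>) * clustering_cost d z P C})"

end

theory Submission
  imports Defs
begin

text \<open>For \<open>\<epsilon>\<close> bounded away from \<open>0\<close> a coreset with at most \<open>k\<close> points would have weighted cost
  \<open>0\<close> for the center set consisting of the coreset itself, so more than \<open>k\<close> points are needed.

  For small \<open>\<epsilon>\<close> let \<open>R\<close> be of order \<open>1 / \<epsilon>\<close> and take the points \<open>R u\<^sub>i + e\<^sub>j\<close> with \<open>i < m\<close>, \<open>j < s\<close>,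
  where the \<open>u\<^sub>i\<close> and \<open>e\<^sub>j\<close> are orthonormal, \<open>m\<close> is of order \<open>k\<close> and \<open>s\<close> of order \<open>\<epsilon>\<^bsup>-z-2\<^esup>\<close>.
  The centers \<open>R u\<^sub>i\<close> serve every point at distance \<open>1\<close>. Remove them for a fraction of about \<open>R\<^bsup>-z\<^esup>\<close>
  of the indices \<open>i\<close>, which are split into groups of about \<open>R\<^sup>2\<close> indices. For each such group and
  each \<open>j\<close> there is room for one further center of norm \<open>R\<close> that has coordinate \<open>R / 2\<close> at \<open>e\<^sub>j\<close> and
  coordinate \<open>1 / 2\<close> at an arbitrary set of the \<open>u\<^sub>i\<close> in the group. Hence for an arbitrary set \<open>T\<close> of
  the points that lost their center one can lower the costs on \<open>T\<close>, and only there, by a relative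
  amount of order \<open>1 / R\<close>, while these points carry a constant fraction of the total cost.
  Taking for \<open>T\<close> the points outside the coreset changes the true cost but not the estimate, so
  \<open>T\<close> is small.\<close>

section \<open>Powers of distances, and coresets of at most \<open>k\<close> points\<close>

lemma euclid_dist_powr:
  "euclid_dist n x y powr z = (\<Sum>i<n. (x i - y i)\<^sup>2) powr (z / 2)"
  by (simp add: euclid_dist_def L2_set_def powr_half_sqrt[symmetric] powr_powr sum_nonneg)

lemma center_setsI:
  assumes "finite C" "C \<noteq> {}" "card C \<le> k" "C \<subseteq> X"
  shows "C \<in> center_sets X k"
proof -
  obtain xs where xs: "set xs = C" "length xs = card C"
    using assms(1) finite_distinct_list distinct_card by metis
  obtain c where "c \<in> C" using assms(2) by blast
  then have "set (xs @ replicate (k - card C) c) = C" "length (xs @ replicate (k - card C) c) = k"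
    using xs assms(3) by auto
  then show ?thesis unfolding center_sets_def using assms(4) by blast
qed

lemma dist_to_set_euclid_powr:
  assumes "finite C" "c \<in> C" "(\<Sum>i<n. (x i - c i)\<^sup>2) = v"
    and "\<And>c'. c' \<in> C \<Longrightarrow> v \<le> (\<Sum>i<n. (x i - c' i)\<^sup>2)"
  shows "dist_to_set (euclid_dist n) x C powr z = v powr (z / 2)"
proof -
  have "dist_to_set (euclid_dist n) x C = euclid_dist n x c"
    unfolding dist_to_set_def
    using assms by (intro Min_eqI) (auto simp: euclid_dist_def L2_set_def)
  then show ?thesis by (simp add: euclid_dist_powr assms(3))
qed

lemma coreset_card_gt:
  assumes cs: "is_coreset X d k z \<epsilon> P S w" and X: "Metric_space X d"
    and P: "finite P" "P \<subseteq> X" "card P > k" and k: "k \<ge> 1" and \<epsilon>: "\<epsilon> < 1"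
  shows "card S > k"
proof (rule ccontr)
  assume "\<not> card S > k"
  then have le: "card S \<le> k" by simp
  have SP: "S \<subseteq> P" using cs by (simp add: is_coreset_def)
  then have fS: "finite S" using P(1) finite_subset by blast
  obtain p where p: "p \<in> P" using P(3) by fastforce
  \<comment> \<open>Since \<open>k \<ge> 1\<close>, no center set is empty; for empty
    \<open>S\<close> some point of \<open>P\<close> stands in.\<close>
  define C where "C = (if S = {} then {p} else S)"
  have C: "finite C" "C \<noteq> {}" "card C \<le> k" "C \<subseteq> X" "S \<subseteq> C"
    using fS le k SP P p by (auto simp: C_def)
  have nonneg: "0 \<le> d x y" for x y using X by (rule Metric_space.nonneg)
  have zero: "d x y = 0 \<longleftrightarrow> x = y" if "x \<in> X" "y \<in> X" for x y
    using X that by (rule Metric_space.zero)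
  have "dist_to_set d x C = 0" if "x \<in> S" for x
    unfolding dist_to_set_def
  proof (rule Min_eqI)
    have "x \<in> C" "x \<in> X" using that C by auto
    then show "0 \<in> d x ` C" using zero[of x x] by (metis image_eqI)
  qed (use C nonneg in auto)
  then have S0: "(\<Sum>x\<in>S. w x * dist_to_set d x C powr z) = 0"
    by simp
  have "\<not> P \<subseteq> C" using C P by (meson card_mono leD le_trans)
  then obtain x where x: "x \<in> P" "x \<notin> C" by blast
  have "dist_to_set d x C \<in> d x ` C"
    unfolding dist_to_set_def using C by (intro Min_in) auto
  then obtain c where "c \<in> C" "dist_to_set d x C = d x c" by blast
  then have "dist_to_set d x C \<noteq> 0"
    using x zero[of x c] C(4) P(2) by auto
  then have "0 < dist_to_set d x C powr z" by simp
  then have "0 < clustering_cost d z P C"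
    unfolding clustering_cost_def using x P by (intro sum_pos2[where i = x]) auto
  moreover have "(1 - \<epsilon>) * clustering_cost d z P C \<le> 0"
    using cs center_setsI[OF C(1-4)] S0 unfolding is_coreset_def by (metis atLeastAtMost_iff)
  ultimately show False using \<epsilon> by (simp add: mult_le_0_iff)
qed

section \<open>The instance and its distances to the centers\<close>

text \<open>The indices \<open>i\<close> form \<open>M\<close> groups of \<open>L\<close>
  consecutive ones, told apart by \<open>i div L\<close>. Coordinates below \<open>M * L\<close>
  carry the first basis vectors, the next \<open>s\<close> carry the second ones, and coordinate
  \<open>M * L + s\<close> is spare; hence \<open>n_gt\<close>.\<close>

locale grid_instance =
  fixes R :: real and L M s n :: nat
  assumes R_ge: "R \<ge> 2" and L_pos: "L > 0" and L_le: "real L \<le> 2 * R\<^sup>2"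
    and n_gt: "n > M * L + s"
begin

definition pt :: "nat \<times> nat \<Rightarrow> nat \<Rightarrow> real" where
  "pt = (\<lambda>(i, j) x. if x = i then R else if x = M * L + j then 1 else 0)"

definition near_center :: "nat \<Rightarrow> nat \<Rightarrow> real" where
  "near_center i x = (if x = i then R else 0)"

definition low :: "(nat \<times> nat) set \<Rightarrow> nat \<Rightarrow> nat \<Rightarrow> nat set" where
  "low T g j = {i. i < M * L \<and> i div L = g \<and> (i, j) \<in> T}"

text \<open>The last coordinate only serves to make the norm equal to \<open>R\<close>, whatever \<open>T\<close> is.\<close>

definition far_center :: "(nat \<times> nat) set \<Rightarrow> nat \<times> nat \<Rightarrow> nat \<Rightarrow> real" where
  "far_center T = (\<lambda>(g, j) x. if x \<in> low T g j then 1 / 2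
     else if x = M * L + j then R / 2
     else if x = M * L + s then sqrt (3 * R\<^sup>2 / 4 - real (card (low T g j)) / 4) else 0)"

definition grid :: "(nat \<times> nat) set" where
  "grid = {..<M * L} \<times> {..<s}"

definition block :: "nat set \<Rightarrow> (nat \<times> nat) set" where
  "block \<Gamma> = {i. i < M * L \<and> i div L \<in> \<Gamma>} \<times> {..<s}"

definition centers :: "nat set \<Rightarrow> (nat \<times> nat) set \<Rightarrow> (nat \<Rightarrow> real) set" where
  "centers \<Gamma> T = near_center ` {i. i < M * L \<and> i div L \<notin> \<Gamma>} \<union> far_center T ` (\<Gamma> \<times> {..<s})"

text \<open>For \<open>p\<close> in the grid this is the squared distance from \<open>pt p\<close>
  to \<open>centers \<Gamma> T\<close>, as \<open>dist_to_centers\<close> shows.\<close>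

definition sq :: "nat set \<Rightarrow> (nat \<times> nat) set \<Rightarrow> nat \<times> nat \<Rightarrow> real" where
  "sq \<Gamma> T p = (if p \<notin> block \<Gamma> then 1 else if p \<in> T then 2 * R\<^sup>2 + 1 - 2 * R else 2 * R\<^sup>2 + 1 - R)"

lemma finite_grid: "finite grid"
  by (simp add: grid_def)

lemma block_subset_grid: "block \<Gamma> \<subseteq> grid"
  by (auto simp: block_def grid_def)

lemma rows_of_group:
  assumes "g < M"
  shows "{i. i < M * L \<and> i div L = g} = {g * L..<g * L + L}"
proof (intro set_eqI iffI)
  fix i assume "i \<in> {i. i < M * L \<and> i div L = g}"
  then have "g * L + i mod L = i" using div_mult_mod_eq[of i L] by simp
  moreover have "i mod L < L" using L_pos by simp
  ultimately show "i \<in> {g * L..<g * L + L}" unfolding atLeastLessThan_iff by linarith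
next
  fix i assume "i \<in> {g * L..<g * L + L}"
  then have i: "g * L \<le> i" "i < g * L + L" by simp_all
  have "Suc g * L \<le> M * L" using assms by (intro mult_right_mono) simp_all
  then have "i < M * L" using i(2) by simp
  moreover have "i div L = g" by (rule div_nat_eqI) (use i in \<open>simp_all add: mult.commute\<close>)
  ultimately show "i \<in> {i. i < M * L \<and> i div L = g}" by simp
qed

lemma card_low_le: "card (low T g j) \<le> L"
proof (cases "g < M")
  case True
  have "low T g j \<subseteq> {i. i < M * L \<and> i div L = g}" by (auto simp: low_def)
  from card_mono[OF _ this] show ?thesis by (simp add: rows_of_group[OF True])
next
  case False
  then have "low T g j = {}"
    using L_pos by (auto simp: low_def less_mult_imp_div_less)
  then show ?thesis by simp
qed

text \<open>A point has only two nonzero coordinates, so among centers of equal norm the entries at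
  \<open>i\<close> and \<open>M * L + j\<close> alone decide which is nearest.\<close>

lemma sum_pt_diff_sq:
  assumes "i < M * L" "j < s"
  shows "(\<Sum>x<n. (pt (i, j) x - c x)\<^sup>2) = (\<Sum>x<n. (c x)\<^sup>2) + R\<^sup>2 + 1 - 2 * R * c i - 2 * c (M * L + j)"
proof -
  have "(\<Sum>x<n. (pt (i, j) x - c x)\<^sup>2) = (\<Sum>x<n. (c x)\<^sup>2 + (if x = i then R\<^sup>2 - 2 * R * c i else 0)
      + (if x = M * L + j then 1 - 2 * c (M * L + j) else 0))"
    using assms by (intro sum.cong) (auto simp: pt_def power2_eq_square algebra_simps)
  also have "\<dots> = (\<Sum>x<n. (c x)\<^sup>2) + (R\<^sup>2 - 2 * R * c i) + (1 - 2 * c (M * L + j))"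
    using assms n_gt by (simp add: sum.distrib)
  finally show ?thesis by simp
qed

lemma sum_near_center_sq:
  assumes "i < M * L"
  shows "(\<Sum>x<n. (near_center i x)\<^sup>2) = R\<^sup>2"
proof -
  have "(\<Sum>x<n. (near_center i x)\<^sup>2) = (\<Sum>x<n. if x = i then R\<^sup>2 else 0)"
    by (intro sum.cong) (auto simp: near_center_def)
  then show ?thesis using assms n_gt by simp
qed

lemma sum_far_center_sq:
  assumes "j < s"
  shows "(\<Sum>x<n. (far_center T (g, j) x)\<^sup>2) = R\<^sup>2"
proof -
  let ?F = "low T g j"
  let ?v = "3 * R\<^sup>2 / 4 - real (card ?F) / 4"
  \<comment> \<open>The entries \<open>1 / 2\<close> contribute at most \<open>L / 4\<close>, hence
    at most half of the squared norm available; the entry \<open>R / 2\<close> takes a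
    quarter.\<close>
  have "real (card ?F) \<le> 2 * R\<^sup>2" using card_low_le[of T g j] L_le by linarith
  then have v: "?v \<ge> 0" using zero_le_power2[of R] by linarith
  have F: "?F \<subseteq> {..<M * L}" by (auto simp: low_def)
  have "(\<Sum>x<n. (far_center T (g, j) x)\<^sup>2) = (\<Sum>x<n. (if x \<in> ?F then 1 / 4 else 0)
      + (if x = M * L + j then R\<^sup>2 / 4 else 0) + (if x = M * L + s then ?v else 0))"
    using assms F v by (intro sum.cong) (auto simp: far_center_def power_divide)
  also have "\<dots> = (\<Sum>x<n. if x \<in> ?F then 1 / 4 else 0) + R\<^sup>2 / 4 + ?v"
    using assms n_gt by (simp add: sum.distrib)
  also have "(\<Sum>x<n. if x \<in> ?F then 1 / 4 else 0 :: real) = (\<Sum>x\<in>?F. 1 / 4)"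
    using F n_gt by (intro sum.mono_neutral_cong_right) auto
  also have "\<dots> = real (card ?F) / 4" by simp
  finally show ?thesis by simp
qed

lemma sum_pt_near_center:
  assumes "i < M * L" "j < s" "i' < M * L"
  shows "(\<Sum>x<n. (pt (i, j) x - near_center i' x)\<^sup>2) = (if i = i' then 1 else 2 * R\<^sup>2 + 1)"
  using sum_pt_diff_sq[OF assms(1,2), of "near_center i'"] assms
  by (auto simp: sum_near_center_sq near_center_def[of _ i] near_center_def[of _ "M * L + j"])
    (simp add: power2_eq_square)

text \<open>The entries \<open>1 / 2\<close> and \<open>R / 2\<close> are balanced: against the
  coordinates \<open>R\<close> and \<open>1\<close> of a point, either one saves exactly
  \<open>R\<close>.\<close>

lemma sum_pt_far_center:
  assumes "i < M * L" "j < s" "j' < s"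
  shows "(\<Sum>x<n. (pt (i, j) x - far_center T (g, j') x)\<^sup>2)
    = 2 * R\<^sup>2 + 1 - (if i \<in> low T g j' then R else 0) - (if j = j' then R else 0)"
proof -
  have "far_center T (g, j') i = (if i \<in> low T g j' then 1 / 2 else 0)"
    using assms by (simp add: far_center_def)
  moreover have "far_center T (g, j') (M * L + j) = (if j = j' then R / 2 else 0)"
    using assms by (auto simp: far_center_def low_def)
  ultimately show ?thesis
    using assms by (simp add: sum_pt_diff_sq sum_far_center_sq)
qed

lemma finite_centers: "finite \<Gamma> \<Longrightarrow> finite (centers \<Gamma> T)"
  by (simp add: centers_def)

text \<open>A block point saves \<open>R\<close> at the far center of its own group and column, and
  \<open>2 * R\<close> there if it lies in \<open>T\<close>. Far centers of another group or column
  save at most \<open>R\<close>, so \<open>T\<close> influences no point outside it. Off the block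
  the near center at distance 1 wins, because \<open>R \<le> R\<^sup>2\<close>.\<close>

lemma dist_to_centers:
  assumes \<Gamma>: "finite \<Gamma>" and p: "p \<in> grid"
  shows "dist_to_set (euclid_dist n) (pt p) (centers \<Gamma> T) powr z = sq \<Gamma> T p powr (z / 2)"
proof -
  obtain i j where p_eq: "p = (i, j)" and ij: "i < M * L" "j < s"
    using p by (auto simp: grid_def)
  have R1: "0 \<le> R" "R \<le> R\<^sup>2" using R_ge by (auto simp: power2_eq_square)
  have "\<exists>c\<in>centers \<Gamma> T. (\<Sum>x<n. (pt p x - c x)\<^sup>2) = sq \<Gamma> T p"
  proof (cases "i div L \<in> \<Gamma>")
    case True
    then have "far_center T (i div L, j) \<in> centers \<Gamma> T"
      using ij by (auto simp: centers_def)
    moreover have "(\<Sum>x<n. (pt p x - far_center T (i div L, j) x)\<^sup>2) = sq \<Gamma> T p"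
      using True ij by (simp add: p_eq sum_pt_far_center sq_def block_def low_def)
    ultimately show ?thesis by blast
  next
    case False
    then have "near_center i \<in> centers \<Gamma> T"
      using ij by (auto simp: centers_def)
    moreover have "(\<Sum>x<n. (pt p x - near_center i x)\<^sup>2) = sq \<Gamma> T p"
      using False ij by (simp add: p_eq sum_pt_near_center sq_def block_def)
    ultimately show ?thesis by blast
  qed
  moreover have "sq \<Gamma> T p \<le> (\<Sum>x<n. (pt p x - c x)\<^sup>2)" if "c \<in> centers \<Gamma> T" for c
    using that unfolding centers_def
  proof
    assume "c \<in> near_center ` {i. i < M * L \<and> i div L \<notin> \<Gamma>}"
    then show ?thesis
      using ij R1 by (auto simp: p_eq sum_pt_near_center sq_def block_def)
  next
    assume "c \<in> far_center T ` (\<Gamma> \<times> {..<s})"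
    then show ?thesis
      using ij R1 by (auto simp: p_eq sum_pt_far_center sq_def block_def low_def)
  qed
  ultimately show ?thesis
    using dist_to_set_euclid_powr[OF finite_centers[OF \<Gamma>]] by blast
qed

lemma pt_in_space: "p \<in> grid \<Longrightarrow> pt p \<in> topspace (Euclidean_space n)"
  using n_gt by (auto simp: pt_def grid_def topspace_Euclidean_space)

lemma centers_subset_space: "centers \<Gamma> T \<subseteq> topspace (Euclidean_space n)"
  using n_gt
  by (auto simp: centers_def near_center_def far_center_def low_def topspace_Euclidean_space)

lemma inj_on_pt: "inj_on pt grid"
proof (rule inj_onI)
  fix p q assume pq: "p \<in> grid" "q \<in> grid" and eq: "pt p = pt q"
  obtain i j i' j' where [simp]: "p = (i, j)" "q = (i', j')" by (metis surj_pair)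
  have "pt p i = pt q i" "pt p (M * L + j) = pt q (M * L + j)" using eq by simp_all
  then show "p = q" using pq R_ge by (auto simp: pt_def grid_def split: if_splits)
qed

lemma centers_in_center_sets:
  assumes "finite \<Gamma>" "\<Gamma> \<noteq> {}" "0 < s" "M * L + card \<Gamma> * s \<le> k"
  shows "centers \<Gamma> T \<in> center_sets (topspace (Euclidean_space n)) k"
proof (rule center_setsI)
  show "centers \<Gamma> T \<noteq> {}" using assms by (auto simp: centers_def)
  have "card (centers \<Gamma> T) \<le> card (near_center ` {i. i < M * L \<and> i div L \<notin> \<Gamma>})
      + card (far_center T ` (\<Gamma> \<times> {..<s}))"
    unfolding centers_def by (rule card_Un_le)
  also have "\<dots> \<le> card {i. i < M * L \<and> i div L \<notin> \<Gamma>} + card (\<Gamma> \<times> {..<s})"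
    using assms by (intro add_mono card_image_le) auto
  also have "card {i. i < M * L \<and> i div L \<notin> \<Gamma>} \<le> card {..<M * L}"
    by (intro card_mono) auto
  finally show "card (centers \<Gamma> T) \<le> k" using assms by (simp add: card_cartesian_product)
qed (use assms finite_centers centers_subset_space in auto)

lemma card_block:
  assumes "\<Gamma> \<subseteq> {..<M}"
  shows "card (block \<Gamma>) = card \<Gamma> * L * s"
proof -
  have "{i. i < M * L \<and> i div L \<in> \<Gamma>} = (\<Union>g\<in>\<Gamma>. {i. i < M * L \<and> i div L = g})" by auto
  also have "card \<dots> = (\<Sum>g\<in>\<Gamma>. card {i. i < M * L \<and> i div L = g})"
    using assms by (intro card_UN_disjoint) (auto intro: finite_subset)
  also have "\<dots> = (\<Sum>g\<in>\<Gamma>. L)"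
    using assms by (intro sum.cong) (auto simp: rows_of_group)
  finally show ?thesis by (simp add: block_def card_cartesian_product)
qed

section \<open>Comparing two center sets on the coreset\<close>

text \<open>The squared distance shrinks by a factor \<open>1 - x\<close> with
  \<open>x \<ge> 1 / (2 * R)\<close>. For \<open>z \<ge> 1\<close> the smallest drop occurs at
  exponent 1/2, where \<open>sqrt (1 - x) \<le> 1 - x / 2\<close>.\<close>

lemma far_cost_drop:
  assumes "z \<ge> 1"
  shows "(2 * R\<^sup>2 + 1 - R) powr (z / 2) / (4 * R)
    \<le> (2 * R\<^sup>2 + 1 - R) powr (z / 2) - (2 * R\<^sup>2 + 1 - 2 * R) powr (z / 2)"
proof -
  define U where "U = 2 * R\<^sup>2 + 1 - R"
  define x where "x = R / U"
  have RR: "2 * R \<le> R\<^sup>2" using R_ge by (simp add: power2_eq_square)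
  have U: "0 < U" "U \<le> 2 * R\<^sup>2" "R < U" using RR R_ge by (auto simp: U_def)
  have x: "0 < x" "x < 1" using U R_ge by (auto simp: x_def)
  have "1 / (2 * R) = R / (2 * R\<^sup>2)" using R_ge by (simp add: power2_eq_square)
  also have "\<dots> \<le> x" unfolding x_def using U R_ge by (intro divide_left_mono) auto
  finally have xR: "1 / (2 * R) \<le> x" .
  have "(1 - x) powr (z / 2) \<le> (1 - x) powr (1 / 2)"
    using x assms by (intro powr_mono') auto
  also have "\<dots> = sqrt (1 - x)" using x by (simp add: powr_half_sqrt)
  also have "\<dots> \<le> 1 - x / 2"
    using x by (intro real_le_lsqrt) (auto simp: power2_eq_square algebra_simps)
  also have "\<dots> \<le> 1 - 1 / (4 * R)" using xR by simp
  finally have *: "(1 - x) powr (z / 2) \<le> 1 - 1 / (4 * R)" .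
  have "2 * R\<^sup>2 + 1 - 2 * R = U * (1 - x)" proof -
    have "U * x = R" using U by (simp add: x_def)
    then show ?thesis by (simp add: right_diff_distrib) (simp add: U_def)
  qed
  then have "(2 * R\<^sup>2 + 1 - 2 * R) powr (z / 2) = U powr (z / 2) * (1 - x) powr (z / 2)"
    using U x by (simp add: powr_mult)
  also have "\<dots> \<le> U powr (z / 2) * (1 - 1 / (4 * R))"
    using * by (intro mult_left_mono) auto
  finally show ?thesis by (simp add: U_def algebra_simps)
qed

text \<open>With \<open>T\<close> the missed block points, the true cost drops by at least
  \<open>card T * A / (4 * R)\<close>, but the coreset property permits only about
  \<open>2 * \<epsilon>\<close> times a total of at most
  \<open>2 * card (block \<Gamma>) * A\<close>. The choice \<open>64 * R * \<epsilon> = 1\<close>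
  turns this into a quarter.\<close>

lemma coreset_misses_at_most_quarter:
  assumes cs: "is_coreset (topspace (Euclidean_space n)) (euclid_dist n) k z \<epsilon> (pt ` grid) (pt ` S) w"
    and S: "S \<subseteq> grid"
    and \<Gamma>: "\<Gamma> \<subseteq> {..<M}" "\<Gamma> \<noteq> {}" and s: "0 < s" and k: "M * L + card \<Gamma> * s \<le> k"
    and z: "z \<ge> 1" and \<epsilon>: "0 < \<epsilon>" "64 * R * \<epsilon> = 1"
    and \<Gamma>_large: "real M \<le> real (card \<Gamma>) * (2 * R\<^sup>2 + 1 - R) powr (z / 2)"
  shows "4 * real (card (block \<Gamma> - S)) \<le> real (card (block \<Gamma>))"
proof -
  define A where "A = (2 * R\<^sup>2 + 1 - R) powr (z / 2)"
  define B where "B = (2 * R\<^sup>2 + 1 - 2 * R) powr (z / 2)"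
  define T where "T = block \<Gamma> - S"
  let ?cost = "\<lambda>T. \<Sum>p\<in>grid. sq \<Gamma> T p powr (z / 2)"
  let ?est = "\<lambda>T. \<Sum>p\<in>S. w (pt p) * sq \<Gamma> T p powr (z / 2)"
  have fin: "finite \<Gamma>" using \<Gamma>(1) finite_subset by blast
  have cost: "clustering_cost (euclid_dist n) z (pt ` grid) (centers \<Gamma> T') = ?cost T'" for T'
    unfolding clustering_cost_def using fin
    by (simp add: sum.reindex[OF inj_on_pt] dist_to_centers)
  have est: "(\<Sum>x\<in>pt ` S. w x * dist_to_set (euclid_dist n) x (centers \<Gamma> T') powr z) = ?est T'" for T'
    unfolding sum.reindex[OF inj_on_subset[OF inj_on_pt S]] o_def using fin S
    by (intro sum.cong) (auto simp: dist_to_centers subset_iff)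
  have bounds: "(1 - \<epsilon>) * ?cost T' \<le> ?est T'" "?est T' \<le> (1 + \<epsilon>) * ?cost T'" for T'
    using cs centers_in_center_sets[OF fin \<Gamma>(2) s k, of T'] cost[of T'] est[of T']
    unfolding is_coreset_def by fastforce+
  \<comment> \<open>\<open>S\<close> avoids \<open>T\<close>, so the estimate cannot tell
    \<open>T\<close> from the empty set.\<close>
  have "?est T = ?est {}"
    by (intro sum.cong) (auto simp: T_def sq_def)
  then have key: "(1 - \<epsilon>) * ?cost {} \<le> (1 + \<epsilon>) * ?cost T"
    using bounds(1)[of "{}"] bounds(2)[of T] by linarith
  have T_block: "T \<subseteq> block \<Gamma>" by (auto simp: T_def)
  have fT: "T \<subseteq> grid"
    using T_block block_subset_grid by (rule subset_trans)
  have "?cost {} - ?cost T = (\<Sum>p\<in>grid. if p \<in> T then A - B else 0)"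
    unfolding sum_subtractf[symmetric] using T_block
    by (intro sum.cong) (auto simp: sq_def A_def B_def)
  also have "\<dots> = (\<Sum>p\<in>T. A - B)"
    using fT finite_grid by (intro sum.mono_neutral_cong_right) auto
  finally have diff: "?cost {} - ?cost T = real (card T) * (A - B)" by simp
  have drop: "A / (4 * R) \<le> A - B"
    using far_cost_drop[OF z] by (simp add: A_def B_def)
  have RR: "2 * R \<le> R\<^sup>2" using R_ge by (simp add: power2_eq_square)
  have A: "0 < A" using RR R_ge by (simp add: A_def)
  have AB: "0 \<le> A - B" using drop A R_ge by (smt (verit) divide_nonneg_nonneg)
  have "?cost {} \<le> (\<Sum>p\<in>grid. 1 + (if p \<in> block \<Gamma> then A else 0))"
    using A by (intro sum_mono) (auto simp: sq_def A_def)
  also have "\<dots> = real (card grid) + (\<Sum>p\<in>grid. if p \<in> block \<Gamma> then A else 0)"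
    by (simp add: sum.distrib)
  also have "(\<Sum>p\<in>grid. if p \<in> block \<Gamma> then A else 0) = (\<Sum>p\<in>block \<Gamma>. A)"
    using finite_grid block_subset_grid by (intro sum.mono_neutral_cong_right) auto
  also have "real (card grid) = real M * (real L * real s)"
    by (simp add: grid_def card_cartesian_product)
  \<comment> \<open>This is where \<open>\<Gamma>_large\<close> enters: unit costs over the whole
    grid amount to no more than the far costs of the block.\<close>
  also have "\<dots> \<le> (real (card \<Gamma>) * A) * (real L * real s)"
    using \<Gamma>_large by (intro mult_right_mono) (auto simp: A_def)
  also have "\<dots> = real (card (block \<Gamma>)) * A"
    by (simp add: card_block[OF \<Gamma>(1)])
  finally have total: "?cost {} \<le> 2 * real (card (block \<Gamma>)) * A" by (simp add: mult_ac)
  have "real (card T) * (A / (4 * R)) \<le> real (card T) * (A - B)"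
    using drop by (intro mult_left_mono) auto
  also have "\<dots> \<le> (1 + \<epsilon>) * (real (card T) * (A - B))"
    using AB \<epsilon> by (simp add: mult_le_cancel_right1 mult_less_0_iff)
  also have "\<dots> \<le> 2 * \<epsilon> * ?cost {}"
    using key unfolding diff[symmetric] by (simp add: algebra_simps)
  also have "\<dots> \<le> 2 * \<epsilon> * (2 * real (card (block \<Gamma>)) * A)"
    using total \<epsilon> by (intro mult_left_mono) auto
  finally have "real (card T) * A / (4 * R) \<le> 4 * \<epsilon> * real (card (block \<Gamma>)) * A"
    by (simp add: mult_ac)
  then have "real (card T) * A \<le> (16 * R * \<epsilon> * real (card (block \<Gamma>))) * A"
    using R_ge by (simp add: field_simps)
  then have "real (card T) \<le> 16 * R * \<epsilon> * real (card (block \<Gamma>))"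
    using A by simp
  moreover have "16 * R * \<epsilon> = 1 / 4" using \<epsilon>(2) by simp
  ultimately show ?thesis by (simp add: T_def)
qed

text \<open>Fewer than \<open>G\<close> groups can be hit sparsely, since \<open>G\<close> sparsely hit groups would
  form a set \<open>\<Gamma>\<close> violating the previous bound.\<close>

lemma coreset_large:
  assumes cs: "is_coreset (topspace (Euclidean_space n)) (euclid_dist n) k z \<epsilon> (pt ` grid) (pt ` S) w"
    and S: "S \<subseteq> grid" and s: "0 < s" and G: "0 < G" and k: "M * L + G * s \<le> k"
    and z: "z \<ge> 1" and \<epsilon>: "0 < \<epsilon>" "64 * R * \<epsilon> = 1"
    and G_large: "real M \<le> real G * (2 * R\<^sup>2 + 1 - R) powr (z / 2)"
    and G_small: "real G \<le> real M / 2 + 1"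
  shows "3 * real M * real L * real s \<le> 8 * real (card S)"
proof -
  define hit where "hit g = block {g} \<inter> S" for g
  \<comment> \<open>If every group of some \<Gamma> stays below three quarters, more than a quarter
    of the block is missed.\<close>
  define Bad where "Bad = {g \<in> {..<M}. 4 * real (card (hit g)) < 3 * real L * real s}"
  have fin: "finite (hit g)" for g
    using S finite_grid finite_subset by (auto simp: hit_def)
  have disj: "hit g \<inter> hit g' = {}" if "g \<noteq> g'" for g g'
    using that by (auto simp: hit_def block_def)
  have sum_hit: "card (\<Union>g\<in>\<Gamma>. hit g) = (\<Sum>g\<in>\<Gamma>. card (hit g))" if "finite \<Gamma>" for \<Gamma>
    using that fin disj by (intro card_UN_disjoint) auto
  have "card Bad < G"
  proof (rule ccontr)
    assume "\<not> card Bad < G"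
    then obtain \<Gamma> where \<Gamma>: "\<Gamma> \<subseteq> Bad" "card \<Gamma> = G" "finite \<Gamma>"
      by (meson not_less obtain_subset_with_card_n)
    have ne: "\<Gamma> \<noteq> {}" using \<Gamma> G by auto
    have \<Gamma>M: "\<Gamma> \<subseteq> {..<M}" using \<Gamma> by (auto simp: Bad_def)
    have quarter: "4 * real (card (block \<Gamma> - S)) \<le> real (card (block \<Gamma>))"
      by (rule coreset_misses_at_most_quarter[OF cs S \<Gamma>M ne s _ z \<epsilon>]) (use \<Gamma> k G_large in simp_all)
    have "block \<Gamma> \<inter> S = (\<Union>g\<in>\<Gamma>. hit g)" by (auto simp: hit_def block_def)
    then have hits: "card (block \<Gamma> \<inter> S) = (\<Sum>g\<in>\<Gamma>. card (hit g))"
      using sum_hit[OF \<Gamma>(3)] by simp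
    have "finite (block \<Gamma>)" using block_subset_grid finite_grid finite_subset by blast
    then have "card (block \<Gamma>) = card (block \<Gamma> \<inter> S) + card (block \<Gamma> - S)"
      by (metis card_Diff_subset_Int card_mono finite_Int inf_le1 le_add_diff_inverse)
    then have "3 * real (card (block \<Gamma>)) \<le> 4 * real (card (block \<Gamma> \<inter> S))"
      using quarter by simp
    also have "\<dots> = (\<Sum>g\<in>\<Gamma>. 4 * real (card (hit g)))"
      by (simp add: hits sum_distrib_left)
    also have "\<dots> < (\<Sum>g\<in>\<Gamma>. 3 * real L * real s)"
      using \<Gamma> ne by (intro sum_strict_mono) (auto simp: Bad_def)
    also have "\<dots> = 3 * real (card (block \<Gamma>))"
      by (simp add: card_block[OF \<Gamma>M])
    finally show False by simp
  qed
  moreover have Bad: "Bad \<subseteq> {..<M}" by (auto simp: Bad_def)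
  then have "real (card ({..<M} - Bad)) = real M - real (card Bad)"
    using card_mono[OF _ Bad] by (simp add: card_Diff_subset finite_subset of_nat_diff)
  \<comment> \<open>The strict bound gives \<open>card Bad \<le> G - 1\<close>, which absorbs the
    \<open>+ 1\<close> in \<open>G_small\<close>.\<close>
  ultimately have "real M / 2 \<le> real (card ({..<M} - Bad))"
    using G_small by linarith
  then have "real M / 2 * (3 * real L * real s) \<le> real (card ({..<M} - Bad)) * (3 * real L * real s)"
    by (intro mult_right_mono) auto
  also have "\<dots> = (\<Sum>g\<in>{..<M} - Bad. 3 * real L * real s)" by simp
  also have "\<dots> \<le> (\<Sum>g\<in>{..<M} - Bad. 4 * real (card (hit g)))"
    by (intro sum_mono) (auto simp: Bad_def)
  also have "\<dots> = 4 * real (card (\<Union>g\<in>{..<M} - Bad. hit g))"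
    by (simp add: sum_hit sum_distrib_left)
  also have "\<dots> \<le> 4 * real (card S)"
    using S finite_grid finite_subset
    by (intro mult_left_mono of_nat_mono card_mono) (auto simp: hit_def)
  finally show ?thesis by simp
qed

end

section \<open>Choice of parameters and the two ranges of \<epsilon>\<close>

text \<open>\<open>L\<close> is the largest group size allowed, \<open>M\<close> spends at most half
  of the \<open>k\<close> centers on near ones, and \<open>G\<close> is the least number of groups
  whose far costs dominate. As \<open>A\<close> is at least \<open>R powr z\<close>, the remaining
  centers suffice for \<open>s\<close> of order \<open>R powr (z + 2)\<close>. Padding with zero
  coordinates lets the dimension exceed any \<open>N\<close>.\<close>

lemma hard_instance_small_eps:
  fixes k N :: nat and z \<epsilon> :: real
  assumes z: "z \<ge> 1" and \<epsilon>: "0 < \<epsilon>" "\<epsilon> \<le> 1 / 128" and k: "\<epsilon> powr (- z - 2) \<le> real k"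
  shows "\<exists>n\<ge>N. \<exists>P. finite P \<and> P \<subseteq> topspace (Euclidean_space n) \<and>
    (\<forall>S w. is_coreset (topspace (Euclidean_space n)) (euclid_dist n) k z \<epsilon> P S w \<longrightarrow>
      (1 / 128) powr (z + 2) / 64 * (real k * \<epsilon> powr (- z - 2)) \<le> real (card S))"
proof -
  define R where "R = 1 / (64 * \<epsilon>)"
  define Q where "Q = R powr (z + 2)"
  define A where "A = (2 * R\<^sup>2 + 1 - R) powr (z / 2)"
  define L where "L = nat \<lfloor>2 * R\<^sup>2\<rfloor>"
  define s where "s = nat \<lfloor>Q / 2\<rfloor>"
  define M where "M = k div (2 * L)"
  define G where "G = nat \<lceil>real M / A\<rceil>"
  define n where "n = max N (M * L + s + 1)"
  have R: "R \<ge> 2" using \<epsilon> by (simp add: R_def field_simps)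
  have eps_eq: "64 * R * \<epsilon> = 1" using \<epsilon> by (simp add: R_def)
  have RR: "2 * R \<le> R\<^sup>2" using R by (simp add: power2_eq_square)
  have "R powr 3 \<le> Q" unfolding Q_def using R z by (intro powr_mono) auto
  moreover have "R powr 3 = R * R\<^sup>2" using R by (simp add: power3_eq_cube power2_eq_square)
  moreover have "2 * R\<^sup>2 \<le> R * R\<^sup>2" using R by (intro mult_right_mono) auto
  ultimately have Q: "2 * R\<^sup>2 \<le> Q" by linarith
  have Q8: "8 \<le> Q" using Q RR R by linarith
  have eps_R: "\<epsilon> powr (- z - 2) = 64 powr (z + 2) * Q"
  proof -
    have "\<epsilon> powr (- z - 2) = 1 / \<epsilon> powr (z + 2)"
      using powr_minus_divide[of \<epsilon> "z + 2"] by simp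
    also have "\<dots> = (1 / \<epsilon>) powr (z + 2)"
      by (simp add: powr_divide)
    also have "1 / \<epsilon> = 64 * R" by (simp add: R_def)
    also have "(64 * R) powr (z + 2) = 64 powr (z + 2) * Q"
      unfolding Q_def by (rule powr_mult)
    finally show ?thesis .
  qed
  \<comment> \<open>The resulting slack \<open>64 * Q \<le> k\<close> pays for all roundings
    below.\<close>
  have "(64::real) powr 1 \<le> 64 powr (z + 2)" using z by (intro powr_mono) auto
  then have "64 * Q \<le> 64 powr (z + 2) * Q" using Q8 by (intro mult_right_mono) auto
  then have kQ: "64 * Q \<le> real k" using k eps_R by linarith
  have L: "real L \<le> 2 * R\<^sup>2" "R\<^sup>2 \<le> real L"
    using RR R unfolding L_def by linarith+
  have L0: "0 < L" using L(2) RR R by (smt (verit) of_nat_0_less_iff)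
  have s: "real s \<le> Q / 2" "Q / 4 \<le> real s" "0 < s"
    using Q8 unfolding s_def by linarith+
  have rows: "2 * real (M * L) \<le> real k" "real k \<le> 4 * real (M * L)"
  proof -
    have "2 * (M * L) \<le> k" using div_times_less_eq_dividend[of k "2 * L"] by (simp add: M_def mult_ac)
    then show "2 * real (M * L) \<le> real k" by (metis of_nat_le_iff of_nat_mult of_nat_numeral)
    have "k < 2 * (M * L) + 2 * L" 
      using dividend_less_div_times[of "2 * L" k] L0 by (simp add: M_def mult_ac)
    then have "real k < 2 * real (M * L) + 2 * real L" by linarith
    then show "real k \<le> 4 * real (M * L)" using L Q kQ Q8 by linarith
  qed
  have M0: "0 < M" using rows(2) kQ Q8 by (cases M) auto
  have Q_A: "Q \<le> A * R\<^sup>2" and A2: "2 \<le> A"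
  proof -
    have "R powr z = (R powr 2) powr (z / 2)" unfolding powr_powr by simp
    also have "R powr 2 = R\<^sup>2" using R by simp
    also have "(R\<^sup>2) powr (z / 2) \<le> A" unfolding A_def using RR R z by (intro powr_mono2) auto
    finally have RA: "R powr z \<le> A" .
    have "Q = R powr z * R\<^sup>2" using R by (simp add: Q_def powr_add)
    then show "Q \<le> A * R\<^sup>2" using RA by (simp add: mult_right_mono)
    have "R powr 1 \<le> R powr z" using R z by (intro powr_mono) auto
    then show "2 \<le> A" using RA R by simp
  qed
  have G0: "0 < G" using M0 A2 by (simp add: G_def)
  have G: "real M / A \<le> real G" "real G \<le> real M / A + 1"
    using A2 unfolding G_def by (auto simp: of_nat_nat)
  have G_large: "real M \<le> real G * A" using G(1) A2 by (simp add: field_simps)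
  have "real M / A \<le> real M / 2" using A2 by (intro divide_left_mono) auto
  then have G_small: "real G \<le> real M / 2 + 1" using G(2) by linarith
  \<comment> \<open>Up to rounding, \<open>G * s\<close> is \<open>M / A * s\<close>, at most half
    of \<open>M * L\<close> because \<open>s \<le> A * L / 2\<close>. Rounding \<open>G\<close> up
    costs one further \<open>s\<close>.\<close>
  have room: "M * L + G * s \<le> k"
  proof -
    have "real M / A * real s \<le> real M / A * (A * real L / 2)"
    proof (intro mult_left_mono)
      have "A * R\<^sup>2 \<le> A * real L" using L A2 by (intro mult_left_mono) auto
      then show "real s \<le> A * real L / 2" using s Q_A by linarith
    qed (use A2 in auto)
    also have "\<dots> = real (M * L) / 2" using A2 by simp
    finally have "real M / A * real s \<le> real (M * L) / 2" .
    moreover have "real G * real s \<le> (real M / A + 1) * real s"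
      using G(2) by (intro mult_right_mono) auto
    ultimately have "real G * real s \<le> real (M * L) / 2 + real s"
      unfolding distrib_right by linarith
    then have "real (M * L + G * s) \<le> real k"
      unfolding of_nat_add of_nat_mult[of G] using rows s kQ Q8 by linarith
    then show ?thesis by (rule of_nat_le_iff[THEN iffD1])
  qed
  interpret grid_instance R L M s n
    by unfold_locales (use R L L0 in \<open>auto simp: n_def\<close>)
  have main: "(1 / 128) powr (z + 2) / 64 * (real k * \<epsilon> powr (- z - 2)) \<le> real (card S)"
    if cs: "is_coreset (topspace (Euclidean_space n)) (euclid_dist n) k z \<epsilon> (pt ` grid) S w" for S w
  proof -
    have "S \<subseteq> pt ` grid" using cs by (simp add: is_coreset_def)
    then obtain S' where S': "S' \<subseteq> grid" "S = pt ` S'" by (meson subset_imageE)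
    have card_eq: "card S = card S'"
      unfolding S'(2) by (rule card_image[OF inj_on_subset[OF inj_on_pt S'(1)]])
    have "3 * real M * real L * real s \<le> 8 * real (card S')"
      using cs unfolding S'(2)
      by (rule coreset_large[OF _ S'(1) s(3) G0 room z \<epsilon>(1) eps_eq G_large[unfolded A_def] G_small])
    moreover have "real (M * L) * real s \<ge> (real k / 4) * (Q / 4)"
      using rows s Q8 by (intro mult_mono) auto
    ultimately have "3 * (real k * Q) \<le> 128 * real (card S)"
      unfolding card_eq by (simp add: mult_ac)
    \<comment> \<open>The factor \<open>(1 / 128) powr (z + 2)\<close> cancels the
      \<open>64 powr (z + 2)\<close> that separates \<open>\<epsilon> powr (- z - 2)\<close> from
      \<open>Q\<close>.\<close>
    moreover have "(1 / 128) powr (z + 2) * (real k * \<epsilon> powr (- z - 2)) \<le> real k * Q"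
    proof -
      have "(1 / 128) powr (z + 2) * 64 powr (z + 2) = (1 / 2 :: real) powr (z + 2)"
        by (subst powr_mult[symmetric]) auto
      also have "\<dots> \<le> 1" using z by (intro powr_le1) auto
      finally have "((1 / 128) powr (z + 2) * 64 powr (z + 2)) * (real k * Q) \<le> 1 * (real k * Q)"
        using Q8 by (intro mult_right_mono) auto
      then show ?thesis by (simp add: eps_R mult_ac)
    qed
    moreover have "0 \<le> real k * Q" using Q8 by simp
    ultimately show ?thesis by simp
  qed
  have "n \<ge> N" by (simp add: n_def)
  moreover have "finite (pt ` grid)" "pt ` grid \<subseteq> topspace (Euclidean_space n)"
    using finite_grid pt_in_space by auto
  ultimately show ?thesis using main by blast
qed

text \<open>Here \<open>1 / (128 * \<epsilon>) \<le> 1\<close>, so the claimed bound is at most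
  \<open>k\<close> and any \<open>k + 1\<close> distinct points will do.\<close>

lemma hard_instance_large_eps:
  fixes k N :: nat and z \<epsilon> :: real
  assumes z: "z \<ge> 1" and \<epsilon>: "1 / 128 \<le> \<epsilon>" "\<epsilon> < 1" and k: "k \<ge> 1"
  shows "\<exists>n\<ge>N. \<exists>P. finite P \<and> P \<subseteq> topspace (Euclidean_space n) \<and>
    (\<forall>S w. is_coreset (topspace (Euclidean_space n)) (euclid_dist n) k z \<epsilon> P S w \<longrightarrow>
      (1 / 128) powr (z + 2) / 64 * (real k * \<epsilon> powr (- z - 2)) \<le> real (card S))"
proof -
  define P :: "(nat \<Rightarrow> real) set" where "P = (\<lambda>t x. if x = 0 then real t else 0) ` {..k}"
  have "inj_on (\<lambda>t x. if x = (0::nat) then real t else 0) {..k}"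
    by (rule inj_onI) (metis of_nat_eq_iff)
  then have cardP: "card P = k + 1" by (simp add: P_def card_image)
  have P: "finite P" "P \<subseteq> topspace (Euclidean_space (N + 1))"
    by (auto simp: P_def topspace_Euclidean_space)
  have "(1 / 128) powr (z + 2) * \<epsilon> powr (- z - 2) = ((1 / 128) / \<epsilon>) powr (z + 2)"
    using \<epsilon> powr_minus[of \<epsilon> "z + 2"] by (subst powr_divide) (auto simp: field_simps)
  also have "\<dots> \<le> 1" using \<epsilon> z by (intro powr_le1) auto
  finally have "((1 / 128) powr (z + 2) * \<epsilon> powr (- z - 2)) * real k \<le> 1 * real k"
    by (intro mult_right_mono) auto
  then have "(1 / 128) powr (z + 2) / 64 * (real k * \<epsilon> powr (- z - 2)) \<le> real k"
    by (simp add: mult_ac)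
  moreover have "k < card S"
    if "is_coreset (topspace (Euclidean_space (N + 1))) (euclid_dist (N + 1)) k z \<epsilon> P S w" for S w
    using coreset_card_gt[OF that Metric_space_euclid_dist P] cardP k \<epsilon> by simp
  ultimately have "(1 / 128) powr (z + 2) / 64 * (real k * \<epsilon> powr (- z - 2)) \<le> real (card S)"
    if "is_coreset (topspace (Euclidean_space (N + 1))) (euclid_dist (N + 1)) k z \<epsilon> P S w" for S w
    using that by (meson less_imp_le of_nat_le_iff order_trans)
  \<comment> \<open>\<open>N + 1\<close> guarantees that coordinate 0 exists even if
    \<open>N = 0\<close>.\<close>
  then show ?thesis using P by (intro exI[of _ "N + 1"]) auto
qed

theorem theorem1p1:
  shows "\<exists>c::real. c > 0 \<and>
    (\<forall>z::real. z \<ge> 1 \<longrightarrow>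
      (\<exists>a b::real. a > 0 \<and> b > 0 \<and>
        (\<forall>(k::nat) (\<epsilon>::real).
          k \<ge> 1 \<and> 0 < \<epsilon> \<and> \<epsilon> < 1 \<and> \<epsilon> \<ge> c * real k powr (- 1 / (z + 2)) \<longrightarrow>
          (\<exists>(n::nat) (P :: (nat \<Rightarrow> real) set).
            real n \<ge> a * (real k * \<epsilon> powr (- z)) \<and>
            finite P \<and> P \<subseteq> topspace (Euclidean_space n) \<and>
            (\<forall>S w. is_coreset (topspace (Euclidean_space n)) (euclid_dist n) k z \<epsilon> P S w \<longrightarrow>
              real (card S) \<ge> b * (real k * \<epsilon> powr (- z - 2)))))))"
proof -
  have main: "\<exists>n P. real n \<ge> 1 * (real k * \<epsilon> powr (- z)) \<and>
      finite P \<and> P \<subseteq> topspace (Euclidean_space n) \<and>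
      (\<forall>S w. is_coreset (topspace (Euclidean_space n)) (euclid_dist n) k z \<epsilon> P S w \<longrightarrow>
        real (card S) \<ge> (1 / 128) powr (z + 2) / 64 * (real k * \<epsilon> powr (- z - 2)))"
    if z: "z \<ge> 1" and k: "k \<ge> 1" and \<epsilon>: "0 < \<epsilon>" "\<epsilon> < 1"
      and bound: "1 * real k powr (- 1 / (z + 2)) \<le> \<epsilon>" for z \<epsilon> :: real and k :: nat
  proof -
    define N where "N = nat \<lceil>real k * \<epsilon> powr (- z)\<rceil>"
    have N: "real n \<ge> 1 * (real k * \<epsilon> powr (- z))" if "n \<ge> N" for n
      using that by (simp add: N_def)
    \<comment> \<open>Raising the lower bound on \<epsilon> to a negative power reverses it and
      gives exactly \<open>k\<close> on the right.\<close>
    have "\<epsilon> powr (- z - 2) \<le> (real k powr (- 1 / (z + 2))) powr (- z - 2)"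
      using bound k z by (intro powr_mono2') auto
    also have "\<dots> = real k powr ((- 1 / (z + 2)) * (- z - 2))" by (rule powr_powr)
    also have "(- 1 / (z + 2)) * (- z - 2) = 1" using z by (simp add: field_simps)
    finally have "\<epsilon> powr (- z - 2) \<le> real k" by simp
    then have "\<exists>n\<ge>N. \<exists>P. finite P \<and> P \<subseteq> topspace (Euclidean_space n) \<and>
      (\<forall>S w. is_coreset (topspace (Euclidean_space n)) (euclid_dist n) k z \<epsilon> P S w \<longrightarrow>
        (1 / 128) powr (z + 2) / 64 * (real k * \<epsilon> powr (- z - 2)) \<le> real (card S))"
      using hard_instance_small_eps[of z \<epsilon> k N] hard_instance_large_eps[of z \<epsilon> k N] z k \<epsilon>
      by (cases "\<epsilon> \<le> 1 / 128") simp_all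
    then obtain n P where "n \<ge> N" "finite P" "P \<subseteq> topspace (Euclidean_space n)"
      "\<forall>S w. is_coreset (topspace (Euclidean_space n)) (euclid_dist n) k z \<epsilon> P S w \<longrightarrow>
        (1 / 128) powr (z + 2) / 64 * (real k * \<epsilon> powr (- z - 2)) \<le> real (card S)"
      by blast
    then show ?thesis using N by blast
  qed
  have pos: "0 < (1 / 128) powr (z + 2) / (64::real)" for z :: real by simp
  show ?thesis
    \<comment> \<open>The witnesses for \<open>c\<close> and \<open>a\<close> are 1; the one for
      \<open>b\<close> is the constant in \<open>main\<close>, which depends on \<open>z\<close>
      alone.\<close>
    by (rule exI[of _ 1], intro conjI zero_less_one allI impI, rule exI[of _ 1],
        rule exI, intro conjI zero_less_one allI impI, rule pos, elim conjE, rule main)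
qed

end
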